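(* Let $K$ be a field, let $n\geq 5$ be an integer, and consider in the polynomial ring $K[x_1,\dots,x_n]$ the ideal $$I_n=(x_1x_2+x_3x_4,\ x_1x_5,\dots,x_1x_n,\ x_3x_5,\dots,x_3x_n).$$ Then $$\operatorname{ara} I_n=n-3.$$ In particular, $I_n$ is not a set-theoretic complete intersection for $n>5$.
   Context: For an ideal $I$ of a Noetherian commutative ring $R$ with identity, elements $p_1,\dots,p_s\in R$ are said to generate $I$ up to radical if $\sqrt{I}=\sqrt{(p_1,\dots,p_s)}$. The arithmetical rank $\operatorname{ara} I$ is the smallest $s$ for which there exist $s$ elements of $R$ generating $I$ up to radical. One always has $\operatorname{height} I\leq \operatorname{ara} I$, and $I$ is called a set-theoretic complete intersection if $\operatorname{height} I=\operatorname{ara} I$. *)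

theory Defs
  imports
    "HOL-Algebra.Algebra"
    "HOL-Algebra.Algebraic_Closure_Type"
    "HOL-Library.Poly_Mapping"
    "HOL-Library.Extended_Nat"
begin

section \<open>Polynomial rings\<close>

text \<open>
  A monomial is a finitely supported exponent function on variable indices, and a polynomial is a
  finitely supported coefficient function on monomials. The type \<open>'k mpoly\<close> has a variable for
  every natural number; \<open>K[x\<^sub>i : i \<in> V]\<close> is the subring of the polynomials all of whose monomials
  involve only variables with index in \<open>V\<close>.
\<close>

type_synonym 'k mpoly = "(nat \<Rightarrow>\<^sub>0 nat) \<Rightarrow>\<^sub>0 'k"

definition var :: "nat \<Rightarrow> 'k::comm_ring_1 mpoly" where
  "var i = Poly_Mapping.single (Poly_Mapping.single i 1) 1"

definition mpoly_ring :: "nat set \<Rightarrow> 'k::comm_ring_1 mpoly ring" where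
  "mpoly_ring V = ring_of_type_algebra
     \<lparr>carrier := {p. \<forall>m \<in> Poly_Mapping.keys p. Poly_Mapping.keys m \<subseteq> V}\<rparr>"

lemma var_in_carrier: "i \<in> V \<Longrightarrow> var i \<in> carrier (mpoly_ring V)"
  by (simp add: var_def mpoly_ring_def)

lemma cring_mpoly_ring: "cring (mpoly_ring V :: 'k::comm_ring_1 mpoly ring)"
proof -
  let ?C = "{p :: 'k mpoly. \<forall>m \<in> Poly_Mapping.keys p. Poly_Mapping.keys m \<subseteq> V}"
  have mult: "p * q \<in> ?C" if "p \<in> ?C" "q \<in> ?C" for p q
  proof (clarify)
    fix m i
    assume "m \<in> Poly_Mapping.keys (p * q)" "i \<in> Poly_Mapping.keys m"
    then obtain a b where "a \<in> Poly_Mapping.keys p" "b \<in> Poly_Mapping.keys q" "m = a + b"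
      using keys_mult[of p q] by blast
    with that \<open>i \<in> Poly_Mapping.keys m\<close> show "i \<in> V"
      using Poly_Mapping.keys_add[of a b] by blast
  qed
  have add: "p + q \<in> ?C" if "p \<in> ?C" "q \<in> ?C" for p q
    using that Poly_Mapping.keys_add[of p q] by blast
  have neg: "- p \<in> ?C" if "p \<in> ?C" for p
    using that by (simp add: Poly_Mapping.keys.rep_eq)
  have one: "1 \<in> ?C" and zero: "0 \<in> ?C"
    by simp_all
  have sel: "carrier (mpoly_ring V) = ?C" "monoid.mult (mpoly_ring V) = (\<lambda>x y :: 'k mpoly. x * y)"
    "monoid.one (mpoly_ring V) = (1 :: 'k mpoly)" "ring.zero (mpoly_ring V) = (0 :: 'k mpoly)"
    "ring.add (mpoly_ring V) = (\<lambda>x y :: 'k mpoly. x + y)"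
    by (simp_all add: mpoly_ring_def ring_of_type_algebra_def)
  have "abelian_group (mpoly_ring V :: 'k mpoly ring)"
  proof (rule abelian_groupI, unfold sel)
    show "\<exists>q\<in>?C. q + p = 0" if "p \<in> ?C" for p
      using neg[OF that] by (intro bexI[of _ "- p"]) (simp only: left_minus)
  qed (fact add zero | simp only: ac_simps add_0_left add_0_right)+
  moreover have "comm_monoid (mpoly_ring V :: 'k mpoly ring)"
    by (rule comm_monoidI, unfold sel) (fact mult one | simp only: ac_simps mult_1_left mult_1_right)+
  ultimately show ?thesis
    by (rule cringI) (unfold sel, rule distrib_right)
qed


section \<open>Radicals, arithmetical rank, height\<close>

definition radical :: "('a, 'b) ring_scheme \<Rightarrow> 'a set \<Rightarrow> 'a set" where
  "radical R I = {a \<in> carrier R. \<exists>k::nat. a [^]\<^bsub>R\<^esub> k \<in> I}"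

text \<open>
  Lists rather than sets, so that the \<open>s\<close> elements need not be distinct. In a Noetherian ring the
  predicate under \<open>LEAST\<close> is satisfiable for every ideal \<open>I\<close>.
\<close>

definition generates_up_to_radical :: "('a, 'b) ring_scheme \<Rightarrow> 'a list \<Rightarrow> 'a set \<Rightarrow> bool" where
  "generates_up_to_radical R ps I \<longleftrightarrow>
     set ps \<subseteq> carrier R \<and> radical R I = radical R (Idl\<^bsub>R\<^esub> (set ps))"

definition ara :: "('a, 'b) ring_scheme \<Rightarrow> 'a set \<Rightarrow> nat" where
  "ara R I = (LEAST s. \<exists>ps. length ps = s \<and> generates_up_to_radical R ps I)"

definition prime_chain :: "('a, 'b) ring_scheme \<Rightarrow> nat \<Rightarrow> (nat \<Rightarrow> 'a set) \<Rightarrow> bool" where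
  "prime_chain R k P \<longleftrightarrow> (\<forall>i\<le>k. primeideal (P i) R) \<and> (\<forall>i<k. P i \<subset> P (Suc i))"

definition prime_height :: "('a, 'b) ring_scheme \<Rightarrow> 'a set \<Rightarrow> enat" where
  "prime_height R Q = Sup {enat k | k. \<exists>P. prime_chain R k P \<and> P k = Q}"

definition height :: "('a, 'b) ring_scheme \<Rightarrow> 'a set \<Rightarrow> enat" where
  "height R I = Inf {prime_height R Q | Q. primeideal Q R \<and> I \<subseteq> Q}"

definition set_theoretic_complete_intersection :: "('a, 'b) ring_scheme \<Rightarrow> 'a set \<Rightarrow> bool" where
  "set_theoretic_complete_intersection R I \<longleftrightarrow> height R I = enat (ara R I)"


section \<open>The ideals under consideration\<close>

definition I_ideal :: "nat \<Rightarrow> 'k::field mpoly set" where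
  "I_ideal n = Idl\<^bsub>mpoly_ring {1..n}\<^esub>
     ({var 1 * var 2 + var 3 * var 4}
      \<union> {var 1 * var j | j. j \<in> {5..n}}
      \<union> {var 3 * var j | j. j \<in> {5..n}})"

end

theory Submission
  imports Defs
begin

text \<open>
  Upper bound: put \<open>q = x\<^sub>1x\<^sub>2 + x\<^sub>3x\<^sub>4\<close> and \<open>m = n - 4\<close>, and write \<open>q\<^bsup>2m\<^esup> = x\<^sub>1\<^bsup>m\<^esup>A + x\<^sub>3\<^bsup>m\<^esup>B\<close>. The \<open>n - 3\<close> elements
  \<open>Aq + x\<^sub>3x\<^sub>n\<close>, \<open>Bq - x\<^sub>1x\<^sub>5\<close> and \<open>x\<^sub>1x\<^bsub>k+1\<^esub> - x\<^sub>3x\<^sub>k\<close> (\<open>5 \<le> k < n\<close>) generate \<open>I\<^sub>n\<close> up to radical: modulo the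
  last ones \<open>x\<^sub>1\<^bsup>m-1\<^esup>x\<^sub>n = x\<^sub>3\<^bsup>m-1\<^esup>x\<^sub>5\<close>, so that there \<open>x\<^sub>1\<^bsup>m\<^esup>\<close> times the first plus \<open>x\<^sub>3\<^bsup>m\<^esup>\<close> times the second is \<open>q\<^bsup>2m+1\<^esup>\<close>.

  Lower bound: the substitution \<open>x\<^sub>1 = 1\<close>, \<open>x\<^sub>3 = x\<^sub>4 = 0\<close> maps \<open>I\<^sub>n\<close> onto the ideal of the origin in
  \<open>K[x\<^sub>2, x\<^sub>5, \<dots>, x\<^sub>n]\<close>, which has \<open>n - 3\<close> variables. If \<open>s\<close> polynomials \<open>p\<^sub>i\<close> without constant term generate the
  ideal of the origin of \<open>K[y\<^sub>1, \<dots>, y\<^sub>N]\<close> up to radical, then modulo terms of degree at least \<open>M\<close> the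
  products \<open>b p\<^sup>\<alpha>\<close>, with \<open>b\<close> from a fixed finite set of monomials and \<open>\<alpha>\<close> below \<open>M\<close>, span all polynomials;
  there are \<open>O(M\<^sup>s)\<close> of them, against \<open>M\<^sup>N\<close> monomials up to a constant, whence \<open>N \<le> s\<close>.

  Height: \<open>I\<^sub>n\<close> lies in the prime \<open>(x\<^sub>1, x\<^sub>3)\<close>, modulo which the other \<open>n - 2\<close> variables are algebraically
  independent. Descending along a chain of primes, an element of \<open>P\<^bsub>i+1\<^esub> - P\<^sub>i\<close> can be added to a family
  that is independent modulo \<open>P\<^bsub>i+1\<^esub>\<close>, giving a family independent modulo \<open>P\<^sub>i\<close>; so the height is at most 2.
\<close>

section \<open>Polynomials as finite sums of terms\<close>

lemma poly_mapping_sum_single: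
  "p = (\<Sum>m\<in>Poly_Mapping.keys p. Poly_Mapping.single m (Poly_Mapping.lookup p m))"
proof (rule poly_mapping_eqI)
  fix k
  show "Poly_Mapping.lookup p k =
    Poly_Mapping.lookup (\<Sum>m\<in>Poly_Mapping.keys p. Poly_Mapping.single m (Poly_Mapping.lookup p m)) k"
    by (simp add: lookup_sum lookup_single when_def in_keys_iff)
qed

text \<open>Every finitely supported function is a finite sum of terms, and the empty sum is itself
  a term with coefficient 0, so terms and sums cover all cases. Additive or multiplicative
  identities for \<open>subst\<close> thereby reduce to single terms.\<close>

lemma poly_mapping_additive_induct [case_names single add]:
  fixes p :: "'a \<Rightarrow>\<^sub>0 'b::comm_monoid_add"
  assumes single: "\<And>m c. P (Poly_Mapping.single m c)"
    and add: "\<And>p q. P p \<Longrightarrow> P q \<Longrightarrow> P (p + q)"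
  shows "P p"
proof -
  have "P (\<Sum>m\<in>A. Poly_Mapping.single m (Poly_Mapping.lookup p m))" if "finite A" for A
    using that by (induction A) (use single[of undefined 0] single add in auto)
  from this[of "Poly_Mapping.keys p"] show ?thesis
    using poly_mapping_sum_single[of p] by simp
qed

lemma keys_add_nat: "Poly_Mapping.keys (a + b) = Poly_Mapping.keys a \<union> Poly_Mapping.keys b"
  for a b :: "nat \<Rightarrow>\<^sub>0 nat"
  by (auto simp: in_keys_iff lookup_add)

section \<open>Substitution\<close>

definition mon :: "(nat \<Rightarrow> 'k::comm_ring_1 mpoly) \<Rightarrow> (nat \<Rightarrow>\<^sub>0 nat) \<Rightarrow> 'k mpoly" where
  "mon g m = (\<Prod>i\<in>Poly_Mapping.keys m. g i ^ Poly_Mapping.lookup m i)"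

text \<open>This is the \<open>K\<close>-algebra endomorphism sending the variable \<open>i\<close>
  to \<open>g i\<close>; \<open>Poly_Mapping.single 0 c\<close> is the constant \<open>c\<close>.
  The same operation serves as specialization of some variables, as evaluation at a point and as
  evaluation of a polynomial at a family of polynomials.\<close>

definition subst :: "(nat \<Rightarrow> 'k::comm_ring_1 mpoly) \<Rightarrow> 'k mpoly \<Rightarrow> 'k mpoly" where
  "subst g p = (\<Sum>m\<in>Poly_Mapping.keys p. Poly_Mapping.single 0 (Poly_Mapping.lookup p m) * mon g m)"

lemma mon_superset:
  assumes "finite A" "Poly_Mapping.keys m \<subseteq> A"
  shows "mon g m = (\<Prod>i\<in>A. g i ^ Poly_Mapping.lookup m i)"
  unfolding mon_def using assms by (intro prod.mono_neutral_left) (auto simp: in_keys_iff)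

lemma mon_add: "mon g (a + b) = mon g a * mon g b"
proof -
  let ?A = "Poly_Mapping.keys a \<union> Poly_Mapping.keys b"
  have "mon g c = (\<Prod>i\<in>?A. g i ^ Poly_Mapping.lookup c i)" if "c \<in> {a, b, a + b}" for c
    using that by (intro mon_superset) (auto simp: keys_add_nat)
  then show ?thesis
    by (simp add: lookup_add power_add prod.distrib)
qed

lemma mon_0 [simp]: "mon g 0 = 1"
  by (simp add: mon_def)

lemma mon_single [simp]: "mon g (Poly_Mapping.single i k) = g i ^ k"
  by (cases "k = 0") (simp_all add: mon_def)

lemma subst_superset:
  assumes "finite A" "Poly_Mapping.keys p \<subseteq> A"
  shows "subst g p = (\<Sum>m\<in>A. Poly_Mapping.single 0 (Poly_Mapping.lookup p m) * mon g m)"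
  unfolding subst_def using assms by (intro sum.mono_neutral_left) (auto simp: in_keys_iff)

lemma subst_add: "subst g (p + q) = subst g p + subst g q"
proof -
  let ?A = "Poly_Mapping.keys p \<union> Poly_Mapping.keys q"
  have "subst g r = (\<Sum>m\<in>?A. Poly_Mapping.single 0 (Poly_Mapping.lookup r m) * mon g m)"
    if "r \<in> {p, q, p + q}" for r
    using that Poly_Mapping.keys_add[of p q] by (intro subst_superset) auto
  then show ?thesis
    by (simp add: lookup_add single_add distrib_right sum.distrib)
qed

lemma subst_single: "subst g (Poly_Mapping.single m c) = Poly_Mapping.single 0 c * mon g m"
  by (cases "c = 0") (simp_all add: subst_def)

lemma subst_0 [simp]: "subst g 0 = 0"
  by (simp add: subst_def)

lemma subst_1 [simp]: "subst g 1 = 1"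
  using subst_single[of g 0 1] by simp

lemma subst_var [simp]: "subst g (var i) = g i"
  by (simp add: var_def subst_single)

lemma subst_mult: "subst g (p * q) = subst g p * subst g q"
proof (induction p rule: poly_mapping_additive_induct)
  case (single m c)
  show ?case
  proof (induction q rule: poly_mapping_additive_induct)
    case (single n d)
    have "subst g (Poly_Mapping.single m c * Poly_Mapping.single n d)
        = Poly_Mapping.single 0 (c * d) * (mon g m * mon g n)"
      by (simp add: mult_single subst_single mon_add)
    also have "Poly_Mapping.single 0 (c * d) = Poly_Mapping.single 0 c * Poly_Mapping.single (0 :: nat \<Rightarrow>\<^sub>0 nat) d"
      by (simp add: mult_single)
    finally show ?case
      by (simp add: subst_single mult_ac)
  next
    case (add p q)
    then show ?case by (simp add: distrib_left subst_add)
  qed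
next
  case (add p q)
  then show ?case by (simp add: distrib_right subst_add)
qed

lemma subst_uminus: "subst g (- p) = - subst g p"
  using subst_add[of g p "- p"] by (simp add: eq_neg_iff_add_eq_0 add.commute)

lemma subst_diff: "subst g (p - q) = subst g p - subst g q"
  using subst_add[of g p "- q"] by (simp add: subst_uminus)

lemma subst_power: "subst g (p ^ k) = subst g p ^ k"
  by (induction k) (simp_all add: subst_mult)

lemma subst_sum: "subst g (sum f A) = (\<Sum>a\<in>A. subst g (f a))"
  by (induction A rule: infinite_finite_induct) (simp_all add: subst_add)

text \<open>Monomials of the ring thus become the special case \<open>g = var\<close> of
  \<open>mon\<close>, so that the span and independence lemmas for \<open>mon\<close> apply to them
  as well.\<close>

lemma mon_var: "mon var m = (Poly_Mapping.single m 1 :: 'k::comm_ring_1 mpoly)"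
proof -
  have *: "Poly_Mapping.single (Poly_Mapping.single i 1) 1 ^ k
      = (Poly_Mapping.single (Poly_Mapping.single i k) 1 :: 'k mpoly)" for i k :: nat
    by (induction k) (simp_all add: mult_single flip: single_add)
  have "(\<Prod>i\<in>A. Poly_Mapping.single (Poly_Mapping.single i (Poly_Mapping.lookup m i)) 1)
      = (Poly_Mapping.single (\<Sum>i\<in>A. Poly_Mapping.single i (Poly_Mapping.lookup m i)) 1 :: 'k mpoly)" for A
    by (induction A rule: infinite_finite_induct) (simp_all add: mult_single)
  then show ?thesis
    using poly_mapping_sum_single[of m] by (simp add: mon_def var_def * flip: One_nat_def)
qed

lemma subst_eq_self:
  assumes "p \<in> carrier (mpoly_ring V)" "\<And>i. i \<in> V \<Longrightarrow> g i = var i"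
  shows "subst g p = p"
proof -
  have "Poly_Mapping.single 0 (Poly_Mapping.lookup p m) * mon g m = Poly_Mapping.single m (Poly_Mapping.lookup p m)"
    if "m \<in> Poly_Mapping.keys p" for m
  proof -
    have "Poly_Mapping.keys m \<subseteq> V"
      using that assms(1) by (auto simp: mpoly_ring_def)
    then have "mon g m = mon var m"
      unfolding mon_def using assms(2) by (intro prod.cong) auto
    then show ?thesis by (simp add: mon_var mult_single)
  qed
  then show ?thesis
    using poly_mapping_sum_single[of p] by (simp add: subst_def)
qed

section \<open>The rings \<open>K[x\<^sub>i : i \<in> V]\<close>\<close>

lemma mpoly_ring_sel:
  "monoid.mult (mpoly_ring V) = (\<lambda>x y :: 'k::comm_ring_1 mpoly. x * y)"
  "monoid.one (mpoly_ring V) = (1 :: 'k mpoly)" "ring.zero (mpoly_ring V) = (0 :: 'k mpoly)"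
  "ring.add (mpoly_ring V) = (\<lambda>x y :: 'k mpoly. x + y)"
  by (simp_all add: mpoly_ring_def ring_of_type_algebra_def)

abbreviation polys :: "nat set \<Rightarrow> 'k::comm_ring_1 mpoly set" where
  "polys V \<equiv> carrier (mpoly_ring V)"

lemma polys_iff: "p \<in> polys V \<longleftrightarrow> (\<forall>m\<in>Poly_Mapping.keys p. Poly_Mapping.keys m \<subseteq> V)"
  by (simp add: mpoly_ring_def)

lemma polys_add: "p \<in> polys V \<Longrightarrow> q \<in> polys V \<Longrightarrow> p + q \<in> polys V"
  using Poly_Mapping.keys_add[of p q] by (auto simp: polys_iff)

lemma polys_mult: "p \<in> polys V \<Longrightarrow> q \<in> polys V \<Longrightarrow> p * q \<in> polys V"
  using monoid.m_closed[OF ring.is_monoid[OF cring.axioms(1)[OF cring_mpoly_ring]], of p V q]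
  by (simp add: mpoly_ring_sel)

lemma polys_const [simp]: "Poly_Mapping.single 0 c \<in> polys V"
  by (cases "c = 0") (simp_all add: polys_iff)

lemma polys_0 [simp]: "0 \<in> polys V" and polys_1 [simp]: "1 \<in> polys V"
  by (simp_all add: polys_iff)

lemma polys_uminus: "p \<in> polys V \<Longrightarrow> - p \<in> polys V"
  using polys_mult[of "- 1" V p] polys_const[of "- 1" V] by (simp add: single_uminus)

lemma polys_diff: "p \<in> polys V \<Longrightarrow> q \<in> polys V \<Longrightarrow> p - q \<in> polys V"
  using polys_add[of p V "- q"] polys_uminus[of q V] by simp

lemma polys_power: "p \<in> polys V \<Longrightarrow> p ^ k \<in> polys V"
  by (induction k) (simp_all add: polys_mult)

lemma polys_sum: "(\<And>a. a \<in> A \<Longrightarrow> f a \<in> polys V) \<Longrightarrow> sum f A \<in> polys V"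
  by (induction A rule: infinite_finite_induct) (simp_all add: polys_add)

lemma polys_prod: "(\<And>a. a \<in> A \<Longrightarrow> f a \<in> polys V) \<Longrightarrow> prod f A \<in> polys V"
  by (induction A rule: infinite_finite_induct) (simp_all add: polys_mult)

lemma polys_single: "Poly_Mapping.keys m \<subseteq> V \<Longrightarrow> Poly_Mapping.single m c \<in> polys V"
  by (cases "c = 0") (simp_all add: polys_iff)

lemmas polys_intros = polys_add polys_mult polys_uminus polys_diff polys_power polys_sum polys_prod
  var_in_carrier

lemma mpoly_ring_power: "p [^]\<^bsub>mpoly_ring V\<^esub> (k::nat) = p ^ k"
  by (induction k) (simp_all add: nat_pow_def mpoly_ring_sel mult_ac)

lemma mon_in_polys:
  assumes "Poly_Mapping.keys m \<subseteq> S" "\<And>i. i \<in> S \<Longrightarrow> g i \<in> polys V"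
  shows "mon g m \<in> polys V"
  unfolding mon_def using assms by (intro polys_prod polys_power) auto

lemma subst_in_polys:
  assumes "F \<in> polys S" "\<And>i. i \<in> S \<Longrightarrow> g i \<in> polys V"
  shows "subst g F \<in> polys V"
  unfolding subst_def using assms
  by (intro polys_sum polys_mult polys_const mon_in_polys[of _ S]) (auto simp: polys_iff)

lemma subst_cong:
  assumes "F \<in> polys S" "\<And>i. i \<in> S \<Longrightarrow> g i = h i"
  shows "subst g F = subst h F"
  unfolding subst_def mon_def using assms
  by (intro sum.cong prod.cong refl arg_cong2[where f = "(*)"]) (auto simp: polys_iff subset_iff)

lemma subst_subst: "subst h (subst g F) = subst (\<lambda>i. subst h (g i)) F"
proof (induction F rule: poly_mapping_additive_induct)
  case (single m c)
  have "subst h (prod f A) = (\<Prod>a\<in>A. subst h (f a))" for f and A :: "nat set"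
    by (induction A rule: infinite_finite_induct) (simp_all add: subst_mult)
  then show ?case
    by (simp add: subst_single subst_mult mon_def subst_power)
next
  case (add p q)
  then show ?case by (simp add: subst_add)
qed

text \<open>Evaluation at the origin kills every monomial other than 1; this turns a vanishing
  constant term into a statement about substitutions, which can be composed.\<close>

lemma subst_zero:
  fixes F :: "'k::comm_ring_1 mpoly"
  shows "subst (\<lambda>_. 0) F = Poly_Mapping.single 0 (Poly_Mapping.lookup F 0)"
proof (induction F rule: poly_mapping_additive_induct)
  case (single m c)
  have "mon (\<lambda>_. 0) m = (0 :: 'k mpoly)" if m: "m \<noteq> 0"
  proof -
    obtain i where "i \<in> Poly_Mapping.keys m"
      using m by (metis all_not_in_conv keys_eq_empty)
    then show ?thesis
      unfolding mon_def by (intro prod_zero bexI[of _ i]) (simp_all add: in_keys_iff zero_power)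
  qed
  then show ?case
    by (cases "m = 0") (simp_all add: subst_single lookup_single)
next
  case (add p q)
  then show ?case by (simp add: subst_add lookup_add single_add)
qed

section \<open>Ideals and radicals in polynomial rings\<close>

lemma ideal_mpoly_ringI:
  assumes "S \<subseteq> polys V" "0 \<in> S" "\<And>a b. a \<in> S \<Longrightarrow> b \<in> S \<Longrightarrow> a + b \<in> S"
    and mult: "\<And>a c. a \<in> S \<Longrightarrow> c \<in> polys V \<Longrightarrow> c * a \<in> S"
  shows "ideal S (mpoly_ring V)"
proof -
  interpret cring "mpoly_ring V :: 'a mpoly ring" by (rule cring_mpoly_ring)
  have inv: "\<exists>b\<in>S. b + a = 0" if "a \<in> S" for a
    using mult[OF that polys_const, of "- 1"] by (intro bexI[of _ "- a"]) (simp_all add: single_uminus)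
  \<comment> \<open>The subgroup condition in \<open>idealI\<close> speaks of the inverse in the
    additive monoid, which is identified here with unary minus.\<close>
  have "inv\<^bsub>\<lparr>carrier = polys V, monoid.mult = (+), one = 0 :: 'a mpoly\<rparr>\<^esub> a = - a" if "a \<in> S" for a
    using that assms(1) minus_equality[of "- a" a]
    by (auto simp: mpoly_ring_sel a_inv_def polys_uminus)
  moreover have "- a \<in> S" if "a \<in> S" for a
    using mult[OF that polys_const, of "- 1"] by (simp add: single_uminus)
  ultimately show ?thesis
    using assms(1-3) mult
    by (intro idealI ring_axioms subgroup.intro)
      (simp_all add: mpoly_ring_sel mult.commute subset_iff)
qed

lemma ideal_mpoly_ringD:
  assumes "ideal S (mpoly_ring V)"
  shows "S \<subseteq> polys V" "0 \<in> S" "a \<in> S \<Longrightarrow> b \<in> S \<Longrightarrow> a + b \<in> S"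
    "a \<in> S \<Longrightarrow> c \<in> polys V \<Longrightarrow> c * a \<in> S"
proof -
  interpret ideal S "mpoly_ring V" by fact
  show "S \<subseteq> polys V"
    by (rule a_subset)
  show "0 \<in> S"
    using additive_subgroup.zero_closed[OF additive_subgroup_axioms] by (simp add: mpoly_ring_sel)
  show "a + b \<in> S" if "a \<in> S" "b \<in> S"
    using additive_subgroup.a_closed[OF additive_subgroup_axioms that] by (simp add: mpoly_ring_sel)
  show "c * a \<in> S" if "a \<in> S" "c \<in> polys V"
    using I_l_closed[OF that] by (simp add: mpoly_ring_sel)
qed

lemma ideal_diff:
  assumes "ideal S (mpoly_ring V)" "a \<in> S" "b \<in> S"
  shows "a - b \<in> S"
  using ideal_mpoly_ringD(3)[OF assms(1,2) ideal_mpoly_ringD(4)[OF assms(1,3) polys_const, of "- 1"]]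
  by (simp add: single_uminus)

lemma radical_mpoly_ring: "a \<in> radical (mpoly_ring V) I \<longleftrightarrow> a \<in> polys V \<and> (\<exists>k. a ^ k \<in> I)"
  by (simp add: radical_def mpoly_ring_power)

text \<open>In each term of the binomial expansion either the exponent of \<open>a\<close> is at
  least \<open>k\<close> or that of \<open>b\<close> is at least \<open>l\<close>.\<close>

lemma power_add_mem:
  assumes I: "ideal I (mpoly_ring V)"
    and ab: "a \<in> polys V" "b \<in> polys V" "a ^ k \<in> I" "b ^ l \<in> I"
  shows "(a + b) ^ (k + l) \<in> I"
proof -
  note ID = ideal_mpoly_ringD[OF I]
  have "of_nat (k + l choose i) * a ^ i * b ^ (k + l - i) \<in> I" for i
  proof (cases "k \<le> i")
    case True
    then have "of_nat (k + l choose i) * a ^ i * b ^ (k + l - i)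
      = (of_nat (k + l choose i) * a ^ (i - k) * b ^ (k + l - i)) * a ^ k"
      using power_add[of a "i - k" k] by (simp add: mult_ac)
    moreover have "of_nat (k + l choose i) * a ^ (i - k) * b ^ (k + l - i) \<in> polys V"
      using polys_const[of "of_nat (k + l choose i)" V] ab by (intro polys_intros) simp_all
    ultimately show ?thesis
      using ID(4)[OF ab(3)] by simp
  next
    case False
    then have "k + l - i = (k - i) + l" by simp
    then have "of_nat (k + l choose i) * a ^ i * b ^ (k + l - i)
      = (of_nat (k + l choose i) * a ^ i * b ^ (k - i)) * b ^ l"
      by (simp add: mult_ac power_add)
    moreover have "of_nat (k + l choose i) * a ^ i * b ^ (k - i) \<in> polys V"
      using polys_const[of "of_nat (k + l choose i)" V] ab by (intro polys_intros) simp_all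
    ultimately show ?thesis
      using ID(4)[OF ab(4)] by simp
  qed
  then have "(\<Sum>i\<in>A. of_nat (k + l choose i) * a ^ i * b ^ (k + l - i)) \<in> I" for A
    by (induction A rule: infinite_finite_induct) (auto intro: ID)
  then show ?thesis
    by (simp add: binomial_ring)
qed

lemma ideal_radical:
  assumes I: "ideal I (mpoly_ring V)"
  shows "ideal (radical (mpoly_ring V) I) (mpoly_ring V)"
proof (rule ideal_mpoly_ringI)
  note ID = ideal_mpoly_ringD[OF I]
  show "radical (mpoly_ring V) I \<subseteq> polys V"
    by (auto simp: radical_mpoly_ring)
  show "0 \<in> radical (mpoly_ring V) I"
    using ID(2) by (auto simp: radical_mpoly_ring intro: exI[of _ 1])
  show "c * a \<in> radical (mpoly_ring V) I" if "a \<in> radical (mpoly_ring V) I" "c \<in> polys V" for a c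
    using that ID(4)[of _ "c ^ _"] by (auto simp: radical_mpoly_ring power_mult_distrib polys_mult polys_power)
  show "a + b \<in> radical (mpoly_ring V) I"
    if "a \<in> radical (mpoly_ring V) I" "b \<in> radical (mpoly_ring V) I" for a b
    using that power_add_mem[OF I] polys_add unfolding radical_mpoly_ring by blast
qed

lemma radical_power_mem:
  assumes "a ^ k \<in> radical (mpoly_ring V) I" "a \<in> polys V"
  shows "a \<in> radical (mpoly_ring V) I"
  using assms by (auto simp: radical_mpoly_ring simp flip: power_mult)

lemma subset_radical: "ideal I (mpoly_ring V) \<Longrightarrow> I \<subseteq> radical (mpoly_ring V) I"
  using ideal_mpoly_ringD(1)[of I V] by (force simp: radical_mpoly_ring intro: exI[of _ 1])

lemma Idl_ideal: "S \<subseteq> polys V \<Longrightarrow> ideal (Idl\<^bsub>mpoly_ring V\<^esub> S) (mpoly_ring V)"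
  by (rule ring.genideal_ideal[OF cring.axioms(1)[OF cring_mpoly_ring]])

lemma Idl_minimal: "ideal I (mpoly_ring V) \<Longrightarrow> S \<subseteq> I \<Longrightarrow> Idl\<^bsub>mpoly_ring V\<^esub> S \<subseteq> I"
  by (rule ring.genideal_minimal[OF cring.axioms(1)[OF cring_mpoly_ring]])

lemma Idl_self: "S \<subseteq> polys V \<Longrightarrow> S \<subseteq> Idl\<^bsub>mpoly_ring V\<^esub> S"
  by (rule ring.genideal_self[OF cring.axioms(1)[OF cring_mpoly_ring]])

text \<open>Since a radical is an ideal and is closed under taking roots, it suffices to test
  generators: each generator in \<open>T\<close> needs only some power in the ideal of
  \<open>S\<close>.\<close>

lemma radical_Idl_eqI:
  assumes "S \<subseteq> polys V" "T \<subseteq> polys V"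
    and "S \<subseteq> Idl\<^bsub>mpoly_ring V\<^esub> T" "T \<subseteq> radical (mpoly_ring V) (Idl\<^bsub>mpoly_ring V\<^esub> S)"
  shows "radical (mpoly_ring V) (Idl\<^bsub>mpoly_ring V\<^esub> T) = radical (mpoly_ring V) (Idl\<^bsub>mpoly_ring V\<^esub> S)"
proof
  have "Idl\<^bsub>mpoly_ring V\<^esub> T \<subseteq> radical (mpoly_ring V) (Idl\<^bsub>mpoly_ring V\<^esub> S)"
    using assms by (intro Idl_minimal ideal_radical Idl_ideal)
  then show "radical (mpoly_ring V) (Idl\<^bsub>mpoly_ring V\<^esub> T) \<subseteq> radical (mpoly_ring V) (Idl\<^bsub>mpoly_ring V\<^esub> S)"
    using radical_power_mem radical_mpoly_ring by blast
  have "Idl\<^bsub>mpoly_ring V\<^esub> S \<subseteq> Idl\<^bsub>mpoly_ring V\<^esub> T"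
    using assms by (intro Idl_minimal Idl_ideal)
  then show "radical (mpoly_ring V) (Idl\<^bsub>mpoly_ring V\<^esub> S) \<subseteq> radical (mpoly_ring V) (Idl\<^bsub>mpoly_ring V\<^esub> T)"
    by (fastforce simp: radical_mpoly_ring)
qed

section \<open>Counting monomials\<close>

text \<open>Scalars act through constant polynomials. The vector space structure makes the exchange
  bound available: an independent set inside the span of a finite set is no larger than that
  set.\<close>

interpretation mp: vector_space "\<lambda>(c::'k::field) (p :: 'k mpoly). Poly_Mapping.single 0 c * p"
  by unfold_locales (simp_all add: algebra_simps single_add mult_single flip: mult.assoc)

definition box :: "nat set \<Rightarrow> nat \<Rightarrow> (nat \<Rightarrow>\<^sub>0 nat) set" where
  "box V L = {m. Poly_Mapping.keys m \<subseteq> V \<and> (\<forall>i\<in>V. Poly_Mapping.lookup m i < L)}"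

text \<open>The inverse extends an exponent function on \<open>V\<close> by zero; finiteness of
  \<open>V\<close> makes the extension finitely supported.\<close>

lemma bij_betw_box:
  assumes "finite V"
  shows "bij_betw (\<lambda>m. restrict (Poly_Mapping.lookup m) V) (box V L) (V \<rightarrow>\<^sub>E {..<L})"
proof (rule bij_betwI)
  show "(\<lambda>m. restrict (Poly_Mapping.lookup m) V) \<in> box V L \<rightarrow> V \<rightarrow>\<^sub>E {..<L}"
    by (auto simp: box_def)
  let ?g = "\<lambda>f. Abs_poly_mapping (\<lambda>i. if i \<in> V then f i else 0) :: nat \<Rightarrow>\<^sub>0 nat"
  have g: "Poly_Mapping.lookup (?g f) = (\<lambda>i. if i \<in> V then f i else 0)" for f
    using assms by (intro lookup_Abs_poly_mapping) (auto intro: finite_subset)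
  show "?g \<in> (V \<rightarrow>\<^sub>E {..<L}) \<rightarrow> box V L"
  proof (rule Pi_I)
    fix f assume "f \<in> V \<rightarrow>\<^sub>E {..<L}"
    then have "f i < L" if "i \<in> V" for i
      using that by (auto simp: PiE_iff)
    then show "?g f \<in> box V L"
      by (auto simp: box_def g in_keys_iff split: if_splits)
  qed
  show "?g (restrict (Poly_Mapping.lookup m) V) = m" if "m \<in> box V L" for m
  proof (rule poly_mapping_eqI)
    fix i
    show "Poly_Mapping.lookup (?g (restrict (Poly_Mapping.lookup m) V)) i = Poly_Mapping.lookup m i"
      using that by (auto simp: box_def g subset_iff not_in_keys_iff_lookup_eq_zero)
  qed
  show "restrict (Poly_Mapping.lookup (?g f)) V = f" if "f \<in> V \<rightarrow>\<^sub>E {..<L}" for f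
    using that by (intro ext) (simp add: g PiE_arb[of f V "\<lambda>_. {..<L}"])
qed

lemma card_box: "finite V \<Longrightarrow> card (box V L) = L ^ card V"
  using bij_betw_same_card[OF bij_betw_box] by (simp add: card_PiE)

lemma finite_box: "finite V \<Longrightarrow> finite (box V L)"
  using bij_betw_finite[OF bij_betw_box] by (simp add: finite_PiE)

text \<open>If \<open>a\<close> exceeded \<open>b\<close>, the bound would already fail at
  \<open>L = C + 1\<close>.\<close>

lemma power_growth:
  fixes a b C :: nat
  assumes "\<And>L. L > 0 \<Longrightarrow> L ^ a \<le> C * L ^ b"
  shows "a \<le> b"
proof (rule ccontr)
  assume "\<not> a \<le> b"
  then have "(C + 1) * (C + 1) ^ b \<le> (C + 1) ^ a"
    using power_increasing[of "Suc b" a "C + 1"] by simp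
  also have "\<dots> \<le> C * (C + 1) ^ b"
    by (rule assms) simp
  finally show False by simp
qed

text \<open>A linear relation between the products \<open>mon y m\<close> is the same as a
  polynomial \<open>F\<close> with \<open>subst y F = 0\<close>, and algebraic independence forces
  such an \<open>F\<close> to vanish.\<close>

lemma independent_mon:
  fixes y :: "nat \<Rightarrow> 'k::field mpoly"
  assumes inj: "\<And>F. F \<in> polys S \<Longrightarrow> F \<noteq> 0 \<Longrightarrow> subst y F \<noteq> 0"
    and A: "\<And>m. m \<in> A \<Longrightarrow> Poly_Mapping.keys m \<subseteq> S"
  shows "inj_on (mon y) A" "mp.independent (mon y ` A)"
proof -
  show inj_on: "inj_on (mon y) A"
  proof (rule inj_onI)
    fix m n assume mn: "m \<in> A" "n \<in> A" "mon y m = mon y n"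
    let ?F = "Poly_Mapping.single m (1::'k) - Poly_Mapping.single n 1"
    have "subst y ?F = 0"
      using mn by (simp add: subst_diff subst_single)
    moreover have "?F \<in> polys S"
      using mn A by (intro polys_diff polys_single) auto
    ultimately have "?F = 0"
      using inj by blast
    then have "Poly_Mapping.lookup ?F m = 0" by simp
    then show "m = n"
      by (simp add: lookup_minus lookup_single when_def split: if_splits)
  qed
  show "mp.independent (mon y ` A)"
  proof (clarsimp simp only: mp.dependent_explicit)
    fix t u v assume t: "finite t" "t \<subseteq> mon y ` A" "(\<Sum>v\<in>t. Poly_Mapping.single 0 (u v) * v) = 0"
      and v: "v \<in> t" "u v \<noteq> (0::'k)"
    obtain A' where A': "A' \<subseteq> A" "t = mon y ` A'"
      using t(2) by (auto simp: subset_image_iff)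
    then have inj': "inj_on (mon y) A'"
      using inj_on inj_on_subset by blast
    then have fin: "finite A'"
      using A' t(1) finite_image_iff by blast
    define F where "F = (\<Sum>m\<in>A'. Poly_Mapping.single m (u (mon y m)))"
    have "subst y F = 0"
      using t(3) by (simp add: F_def A' subst_sum subst_single sum.reindex[OF inj'])
    moreover have "F \<in> polys S"
      unfolding F_def using A A' by (intro polys_sum polys_single) auto
    ultimately have "F = 0"
      using inj by blast
    obtain m where m: "m \<in> A'" "v = mon y m"
      using v(1) A' by auto
    have "Poly_Mapping.lookup F m = u v"
      using m fin by (simp add: F_def lookup_sum lookup_single when_def)
    then show False
      using v \<open>F = 0\<close> by simp
  qed
qed

lemma mem_span_mon_var:
  fixes p :: "'k::field mpoly"
  assumes "Poly_Mapping.keys p \<subseteq> A"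
  shows "p \<in> mp.span (mon var ` A)"
proof -
  have "p = (\<Sum>m\<in>Poly_Mapping.keys p. Poly_Mapping.single 0 (Poly_Mapping.lookup p m) * mon var m)"
    using poly_mapping_sum_single[of p] by (simp add: mon_var mult_single)
  moreover have "\<dots> \<in> mp.span (mon var ` A)"
    using assms by (intro mp.span_sum mp.span_scale mp.span_base) auto
  ultimately show ?thesis by simp
qed

text \<open>A bound on the transcendence degree by counting: the \<open>L ^ card S\<close> products
  of the \<open>y i\<close> with exponents below \<open>L\<close> are linearly independent, yet they
  only involve monomials in the variables of \<open>V\<close> with exponents bounded linearly in
  \<open>L\<close>. Comparing growth in \<open>L\<close> gives the inequality.\<close>

lemma alg_indep_card_le:
  fixes y :: "nat \<Rightarrow> 'k::field mpoly"
  assumes fin: "finite S" "finite V"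
    and y: "\<And>i. i \<in> S \<Longrightarrow> y i \<in> polys V"
    and inj: "\<And>F. F \<in> polys S \<Longrightarrow> F \<noteq> 0 \<Longrightarrow> subst y F \<noteq> 0"
  shows "card S \<le> card V"
proof -
  define bnd :: "nat \<Rightarrow> 'k mpoly set" where
    "bnd D = {p \<in> polys V. \<forall>m\<in>Poly_Mapping.keys p. \<forall>j. Poly_Mapping.lookup m j \<le> D}" for D
  have bnd_mult: "p * q \<in> bnd (a + b)" if "p \<in> bnd a" "q \<in> bnd b" for p q a b
    using that keys_mult[of p q] by (fastforce simp: bnd_def lookup_add polys_mult intro: add_mono)
  have bnd_power: "p ^ k \<in> bnd (k * a)" if "p \<in> bnd a" for p k a
  proof (induction k)
    case 0
    show ?case by (simp add: bnd_def)
  next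
    case (Suc k)
    then show ?case using bnd_mult[OF that] by simp
  qed
  have bnd_prod: "(\<Prod>i\<in>A. f i) \<in> bnd (\<Sum>i\<in>A. a i)" if "\<And>i. i \<in> A \<Longrightarrow> f i \<in> bnd (a i)"
    for f a and A :: "nat set"
    using that by (induction A rule: infinite_finite_induct) (auto simp: bnd_mult, simp_all add: bnd_def)
  \<comment> \<open>All nonzero exponents occurring in some \<open>y i\<close>; their maximum yields
    a common bound \<open>D\<close>.\<close>
  define exps where "exps = \<Union> (Poly_Mapping.range ` (\<Union> ((\<lambda>i. Poly_Mapping.keys (y i)) ` S)))"
  have "finite exps"
    using fin by (simp add: exps_def)
  then obtain D where D: "\<forall>x\<in>exps. x \<le> D"
    using finite_nat_set_iff_bounded_le[of exps] by auto
  have yD: "y i \<in> bnd D" if "i \<in> S" for i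
  proof -
    have "Poly_Mapping.lookup m j \<le> D" if "m \<in> Poly_Mapping.keys (y i)" for m j
    proof (cases "Poly_Mapping.lookup m j = 0")
      case False
      then have "Poly_Mapping.lookup m j \<in> exps"
        using that \<open>i \<in> S\<close> by (auto simp: exps_def in_keys_iff intro!: bexI)
      then show ?thesis using D by simp
    qed simp
    then show ?thesis
      using y[OF that] by (simp add: bnd_def)
  qed
  show ?thesis
  proof (rule power_growth)
    fix L :: nat assume L: "L > 0"
    \<comment> \<open>\<open>?D\<close> bounds each exponent in a product \<open>mon y m\<close>
      with \<open>m\<close> in \<open>box S L\<close>; the box below has side \<open>?D + 1\<close>
      because its inequality is strict.\<close>
    let ?D = "card S * D * L" and ?E = "mon y ` box S L"
    have "mon y m \<in> mp.span (mon var ` box V (?D + 1))" if m: "m \<in> box S L" for m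
    proof (rule mem_span_mon_var)
      have "mon y m = (\<Prod>i\<in>S. y i ^ Poly_Mapping.lookup m i)"
        using m fin by (intro mon_superset) (auto simp: box_def)
      also have "\<dots> \<in> bnd (\<Sum>i\<in>S. Poly_Mapping.lookup m i * D)"
        by (intro bnd_prod bnd_power yD)
      finally have "mon y m \<in> bnd (\<Sum>i\<in>S. Poly_Mapping.lookup m i * D)" .
      moreover have "(\<Sum>i\<in>S. Poly_Mapping.lookup m i * D) \<le> (\<Sum>i\<in>S. L * D)"
        using m by (intro sum_mono mult_right_mono) (auto simp: box_def intro: less_imp_le)
      ultimately show "Poly_Mapping.keys (mon y m) \<subseteq> box V (?D + 1)"
        by (fastforce simp: bnd_def box_def polys_iff mult_ac intro: le_imp_less_Suc order_trans)
    qed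
    moreover have ind: "inj_on (mon y) (box S L)" "mp.independent ?E"
      using independent_mon[OF inj, where A = "box S L"] by (auto simp: box_def)
    ultimately have "card ?E \<le> card ((mon var :: _ \<Rightarrow> 'k mpoly) ` box V (?D + 1))"
      using fin finite_box by (intro conjunct2[OF mp.independent_span_bound]) auto
    also have "\<dots> \<le> (?D + 1) ^ card V"
      using card_image_le[OF finite_box[OF fin(2)]] card_box[OF fin(2)] by metis
    also have "\<dots> \<le> ((card S * D + 1) * L) ^ card V"
      using L by (intro power_mono) (auto simp: algebra_simps)
    also have "\<dots> = (card S * D + 1) ^ card V * L ^ card V"
      by (rule power_mult_distrib)
    finally show "L ^ card S \<le> (card S * D + 1) ^ card V * L ^ card V"
      using fin ind by (simp only: card_image card_box)
  qed
qed

text \<open>An elementary form of the height bound for the ideal of the origin. Repeated division by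
  the \<open>p i\<close> writes each polynomial as a combination of products of powers of the
  \<open>p i\<close> with remainders from a fixed finite-dimensional space, up to terms of high
  degree.\<close>

lemma origin_ideal_card_le:
  fixes p :: "nat \<Rightarrow> 'k::field mpoly"
  assumes V: "finite V"
    and p: "\<And>i. i < s \<Longrightarrow> p i \<in> polys V" "\<And>i. i < s \<Longrightarrow> Poly_Mapping.lookup (p i) 0 = 0"
    and k: "k > 0"
    and h: "\<And>v i. v \<in> V \<Longrightarrow> i < s \<Longrightarrow> h v i \<in> polys V"
      "\<And>v. v \<in> V \<Longrightarrow> var v ^ k = (\<Sum>i<s. h v i * p i)"
  shows "card V \<le> s"
proof (cases "card V = 0")
  case False
  then have "card V > 0" by simp
  define B :: "'k mpoly set" where "B = mon var ` box V k"
  \<comment> \<open>A monomial outside \<open>box V k\<close> is divisible by some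
    \<open>var v ^ k\<close>, hence lies in the ideal of the \<open>p i\<close>; the remaining
    monomials form the finite set \<open>B\<close>.\<close>
  have decomp: "\<exists>b g. b \<in> mp.span B \<and> (\<forall>i<s. g i \<in> polys V) \<and> f = b + (\<Sum>i<s. g i * p i)"
    if f: "f \<in> polys V" for f
  proof -
    define Q where "Q f \<longleftrightarrow> (\<exists>b g. b \<in> mp.span B \<and> (\<forall>i<s. g i \<in> polys V) \<and> f = b + (\<Sum>i<s. g i * p i))" for f
    have Q_add: "Q (f + f')" if "Q f" "Q f'" for f f'
    proof -
      from that obtain b g b' g' where "b \<in> mp.span B" "b' \<in> mp.span B" "\<forall>i<s. g i \<in> polys V"
        "\<forall>i<s. g' i \<in> polys V" "f = b + (\<Sum>i<s. g i * p i)" "f' = b' + (\<Sum>i<s. g' i * p i)"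
        by (auto simp: Q_def)
      then show ?thesis
        unfolding Q_def
        by (intro exI[of _ "b + b'"] exI[of _ "\<lambda>i. g i + g' i"])
          (auto simp: mp.span_add polys_add distrib_right sum.distrib algebra_simps)
    qed
    have Q_single: "Q (Poly_Mapping.single m c)" if m: "Poly_Mapping.keys m \<subseteq> V" for m c
    proof (cases "m \<in> box V k")
      case True
      then have "Poly_Mapping.single m c \<in> mp.span B"
        unfolding B_def by (intro mem_span_mon_var) auto
      then show ?thesis
        unfolding Q_def by (intro exI[of _ "Poly_Mapping.single m c"] exI[of _ "\<lambda>i. 0"]) auto
    next
      case False
      then obtain v where v: "v \<in> V" "Poly_Mapping.lookup m v \<ge> k"
        using m by (auto simp: box_def not_less)
      define m' where "m' = m - Poly_Mapping.single v k"
      have m': "m = m' + Poly_Mapping.single v k"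
        using v(2) unfolding m'_def
        by (intro poly_mapping_eqI) (auto simp: lookup_add lookup_minus lookup_single when_def)
      then have "Poly_Mapping.keys m' \<subseteq> V"
        using m by (simp add: keys_add_nat)
      then have g: "\<forall>i<s. Poly_Mapping.single m' c * h v i \<in> polys V"
        using h(1) v by (auto intro: polys_mult polys_single)
      have "Poly_Mapping.single m c = Poly_Mapping.single m' c * var v ^ k"
      proof -
        have "var v ^ k = (Poly_Mapping.single (Poly_Mapping.single v k) 1 :: 'k mpoly)"
          using mon_single[of var v k, symmetric] by (simp only: mon_var)
        then show ?thesis
          by (simp add: m' mult_single)
      qed
      also have "\<dots> = (\<Sum>i<s. (Poly_Mapping.single m' c * h v i) * p i)"
        by (simp add: h(2)[OF v(1)] sum_distrib_left mult.assoc)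
      finally show ?thesis
        using g unfolding Q_def
        by (intro exI[of _ 0] exI[of _ "\<lambda>i. Poly_Mapping.single m' c * h v i"]) (simp add: mp.span_zero)
    qed
    have "Q (\<Sum>m\<in>A. Poly_Mapping.single m (Poly_Mapping.lookup f m))"
      if "finite A" "A \<subseteq> Poly_Mapping.keys f" for A
      using that
    proof (induction A)
      case empty
      show ?case using Q_single[of 0 0] by simp
    next
      case (insert m A)
      then have "Poly_Mapping.keys m \<subseteq> V"
        using f by (auto simp: polys_iff)
      with insert show ?case by (auto intro: Q_add Q_single)
    qed
    from this[of "Poly_Mapping.keys f"] show ?thesis
      using poly_mapping_sum_single[of f] by (simp add: Q_def)
  qed
  \<comment> \<open>\<open>dg\<close> is the total degree in the variables of \<open>V\<close>, and
    \<open>Dn M\<close> consists of the polynomials without terms of degree below \<open>M\<close>.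
    Each \<open>p i\<close> lies in \<open>Dn 1\<close> because its constant term vanishes.\<close>
  define dg where "dg m = (\<Sum>i\<in>V. Poly_Mapping.lookup m i)" for m :: "nat \<Rightarrow>\<^sub>0 nat"
  define Dn :: "nat \<Rightarrow> 'k mpoly set" where "Dn M = {f. \<forall>m\<in>Poly_Mapping.keys f. M \<le> dg m}" for M
  have dg_add: "dg (m + n) = dg m + dg n" for m n
    by (simp add: dg_def lookup_add sum.distrib)
  have Dn_mult: "f * g \<in> Dn (a + b)" if "f \<in> Dn a" "g \<in> Dn b" for f g a b
    using that keys_mult[of f g] by (fastforce simp: Dn_def dg_add intro: add_mono)
  have Dn_0: "f \<in> Dn 0" for f
    by (simp add: Dn_def)
  have Dn_p: "p i \<in> Dn 1" if "i < s" for i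
  proof -
    have "dg m \<ge> 1" if m: "m \<in> Poly_Mapping.keys (p i)" for m
    proof -
      have "m \<noteq> 0"
        using m p(2)[OF \<open>i < s\<close>] by (auto simp: in_keys_iff)
      then obtain j where "j \<in> Poly_Mapping.keys m"
        using keys_eq_empty by blast
      moreover have "Poly_Mapping.keys m \<subseteq> V"
        using m p(1)[OF \<open>i < s\<close>] by (auto simp: polys_iff)
      ultimately have "j \<in> V" "Poly_Mapping.lookup m j \<noteq> 0"
        by (auto simp: in_keys_iff)
      then have "dg m \<noteq> 0"
        using V by (auto simp: dg_def)
      then show ?thesis by simp
    qed
    then show ?thesis by (simp add: Dn_def)
  qed
  have Dn_power: "p i ^ a \<in> Dn a" if "i < s" for i a
  proof (induction a)
    case (Suc a)
    then show ?case using Dn_mult[OF Dn_p[OF that]] by simp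
  qed (rule Dn_0)
  define pp where "pp \<alpha> = (\<Prod>i<s. p i ^ \<alpha> i)" for \<alpha> :: "nat \<Rightarrow> nat"
  have "(\<Prod>i\<in>I. p i ^ \<alpha> i) \<in> Dn (\<Sum>i\<in>I. \<alpha> i)" if "I \<subseteq> {..<s}" "finite I" for I and \<alpha> :: "nat \<Rightarrow> nat"
    using that(2,1) by (induction I) (auto simp: Dn_0 Dn_power Dn_mult)
  then have Dn_pp: "pp \<alpha> \<in> Dn (\<Sum>i<s. \<alpha> i)" for \<alpha>
    by (simp add: pp_def)
  have pp_upd: "pp (\<alpha>(i := Suc (\<alpha> i))) = pp \<alpha> * p i"
    and sum_upd: "(\<Sum>j<s. (\<alpha>(i := Suc (\<alpha> i))) j) = Suc (\<Sum>j<s. \<alpha> j)" if "i < s" for \<alpha> i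
  proof -
    have "(\<Prod>j\<in>{..<s} - {i}. p j ^ (\<alpha>(i := Suc (\<alpha> i))) j) = (\<Prod>j\<in>{..<s} - {i}. p j ^ \<alpha> j)"
      by (intro prod.cong) auto
    then show "pp (\<alpha>(i := Suc (\<alpha> i))) = pp \<alpha> * p i"
      using that unfolding pp_def
      by (simp only: prod.remove[of "{..<s}" i] finite_lessThan lessThan_iff) (simp add: mult_ac)
    have "(\<Sum>j\<in>{..<s} - {i}. (\<alpha>(i := Suc (\<alpha> i))) j) = (\<Sum>j\<in>{..<s} - {i}. \<alpha> j)"
      by (intro sum.cong) auto
    then show "(\<Sum>j<s. (\<alpha>(i := Suc (\<alpha> i))) j) = Suc (\<Sum>j<s. \<alpha> j)"
      using that by (simp only: sum.remove[of "{..<s}" i] finite_lessThan lessThan_iff) simp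
  qed
  show ?thesis
  proof (rule power_growth)
    fix L :: nat assume L: "L > 0"
    define M where "M = card V * L"
    define A where "A = box V L"
    \<comment> \<open>\<open>T\<close> is the linear projection onto the monomials in
      \<open>A = box V L\<close>. These have degree below \<open>M = card V * L\<close>, so
      \<open>T\<close> kills \<open>Dn M\<close>.\<close>
    define T :: "'k mpoly \<Rightarrow> 'k mpoly" where
      "T f = (\<Sum>m\<in>A. Poly_Mapping.single m (Poly_Mapping.lookup f m))" for f
    have finA: "finite A"
      by (simp add: A_def finite_box V)
    have lookup_T: "Poly_Mapping.lookup (T f) m = (if m \<in> A then Poly_Mapping.lookup f m else 0)" for f m
      using finA by (simp add: T_def lookup_sum lookup_single when_def)
    have T_add: "T (f + g) = T f + T g" for f g
      by (intro poly_mapping_eqI) (simp add: lookup_T lookup_add)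
    have T_0: "T 0 = 0"
      by (intro poly_mapping_eqI) (simp add: lookup_T)
    have T_sum: "T (\<Sum>i\<in>I. f i) = (\<Sum>i\<in>I. T (f i))" for f and I :: "nat set"
      by (induction I rule: infinite_finite_induct) (simp_all add: T_0 T_add)
    have T_scale: "T (Poly_Mapping.single 0 c * f) = Poly_Mapping.single 0 c * T f" for c f
      by (intro poly_mapping_eqI)
        (simp add: lookup_T Poly_Mapping.map.rep_eq when_def flip: mult_map_scale_conv_mult)
    have T_mon: "T (mon var m) = mon var m" if "m \<in> A" for m
      using that by (intro poly_mapping_eqI) (auto simp: lookup_T mon_var lookup_single when_def)
    have T_Dn: "T f = 0" if "f \<in> Dn M" for f
    proof -
      \<comment> \<open>The strict inequality requires \<open>V\<close> to be nonempty, which is why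
        \<open>card V = 0\<close> is split off at the start.\<close>
      have "dg m < M" if "m \<in> A" for m
      proof -
        have "dg m < (\<Sum>i\<in>V. L)"
          unfolding dg_def using that V \<open>card V > 0\<close>
          by (intro sum_strict_mono) (auto simp: A_def box_def card_gt_0_iff)
        then show ?thesis by (simp add: M_def)
      qed
      then show ?thesis
        using that
        by (intro poly_mapping_eqI) (auto simp: lookup_T Dn_def simp flip: not_in_keys_iff_lookup_eq_zero not_le)
    qed
    define W where "W = (\<lambda>(\<alpha>, b). pp \<alpha> * b) ` (({..<s} \<rightarrow>\<^sub>E {..<M}) \<times> B)"
    have finB: "finite B" and cardB: "card B \<le> k ^ card V"
      using card_image_le[OF finite_box[OF V], of "mon var" k] by (auto simp: B_def finite_box V card_box)
    have finW: "finite W"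
      by (simp add: W_def finB finite_PiE)
    have span_B: "T (pp \<alpha> * b) \<in> mp.span (T ` W)" if b: "b \<in> mp.span B" and \<alpha>: "(\<Sum>i<s. \<alpha> i) < M" for \<alpha> b
      using b
    proof (induction rule: mp.span_induct_alt)
      case base
      show ?case by (simp add: T_0 mp.span_zero)
    next
      case (step c x y)
      have "\<alpha> i < M" if "i < s" for i
        using member_le_sum[of i "{..<s}" \<alpha>] that \<alpha> by simp
      \<comment> \<open>Restriction to the indices below \<open>s\<close> makes the exponents a
        member of the finite function space in \<open>W\<close> and leaves \<open>pp\<close>
        unchanged.\<close>
      then have "restrict \<alpha> {..<s} \<in> {..<s} \<rightarrow>\<^sub>E {..<M}" by auto
      moreover have "pp \<alpha> = pp (restrict \<alpha> {..<s})"
        by (simp add: pp_def)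
      ultimately have "pp \<alpha> * x \<in> W"
        using step(1) unfolding W_def by (intro image_eqI[of _ _ "(restrict \<alpha> {..<s}, x)"]) auto
      then have "Poly_Mapping.single 0 c * T (pp \<alpha> * x) \<in> mp.span (T ` W)"
        by (intro mp.span_scale mp.span_base) auto
      moreover have "T (pp \<alpha> * (Poly_Mapping.single 0 c * x + y))
          = Poly_Mapping.single 0 c * T (pp \<alpha> * x) + T (pp \<alpha> * y)"
        by (simp add: distrib_left T_add mult.left_commute[of "pp \<alpha>"] T_scale)
      ultimately show ?case
        using step(2) by (simp add: mp.span_add)
    qed
    \<comment> \<open>Decompose \<open>f\<close>: the remainder in the span of \<open>B\<close> is
      handled by \<open>span_B\<close>, and every \<open>g i * p i\<close> moves a factor
      \<open>p i\<close> into \<open>pp\<close>, raising the sum of the exponents. Once this sum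
      reaches \<open>M\<close>, the product lies in \<open>Dn M\<close> and \<open>T\<close> sends
      it to 0.\<close>
    have span: "T (pp \<alpha> * f) \<in> mp.span (T ` W)" if "f \<in> polys V" for \<alpha> f
      using that
    proof (induction "M - (\<Sum>i<s. \<alpha> i)" arbitrary: \<alpha> f rule: less_induct)
      case less
      show ?case
      proof (cases "M \<le> (\<Sum>i<s. \<alpha> i)")
        case True
        have "pp \<alpha> * f \<in> Dn (\<Sum>i<s. \<alpha> i)"
          using Dn_mult[OF Dn_pp Dn_0] by simp
        then have "pp \<alpha> * f \<in> Dn M"
          using True by (auto simp: Dn_def)
        then show ?thesis by (simp add: T_Dn mp.span_zero)
      next
        case False
        obtain b g where bg: "b \<in> mp.span B" "\<forall>i<s. g i \<in> polys V" "f = b + (\<Sum>i<s. g i * p i)"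
          using decomp[OF less.prems] by blast
        have "pp \<alpha> * f = pp \<alpha> * b + (\<Sum>i<s. pp (\<alpha>(i := Suc (\<alpha> i))) * g i)"
          by (simp add: bg(3) distrib_left sum_distrib_left pp_upd mult_ac)
        moreover have "T (pp (\<alpha>(i := Suc (\<alpha> i))) * g i) \<in> mp.span (T ` W)" if "i < s" for i
          using False that bg(2) by (intro less.hyps) (auto simp only: sum_upd)
        ultimately show ?thesis
          using span_B[OF bg(1)] False by (auto simp: T_add T_sum intro!: mp.span_add mp.span_sum)
      qed
    qed
    have mon_span: "mon var m \<in> mp.span (T ` W)" if "m \<in> A" for m
    proof -
      have "mon var m \<in> polys V"
        using that unfolding mon_var by (intro polys_single) (auto simp: A_def box_def)
      from span[OF this, of "\<lambda>_. 0"] show ?thesis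
        by (simp add: pp_def T_mon that)
    qed
    \<comment> \<open>The \<open>L ^ card V\<close> monomials in \<open>A\<close> are fixed by
      \<open>T\<close> and independent, so their number is at most \<open>card W\<close>, which is
      at most a constant times \<open>L ^ s\<close>.\<close>
    have "subst var F = F" for F :: "'k mpoly"
      by (rule subst_eq_self[of _ UNIV]) (auto simp: polys_iff)
    then have ind: "inj_on (mon var :: _ \<Rightarrow> 'k mpoly) A" "mp.independent ((mon var :: _ \<Rightarrow> 'k mpoly) ` A)"
      using independent_mon[of UNIV "var :: _ \<Rightarrow> 'k mpoly" A] by auto
    have "L ^ card V = card ((mon var :: _ \<Rightarrow> 'k mpoly) ` A)"
      using ind by (simp add: card_image A_def card_box V)
    also have "\<dots> \<le> card (T ` W)"
      using finW ind mon_span by (intro conjunct2[OF mp.independent_span_bound]) auto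
    also have "\<dots> \<le> card W"
      by (rule card_image_le[OF finW])
    also have "\<dots> \<le> card (({..<s} \<rightarrow>\<^sub>E {..<M}) \<times> B)"
      unfolding W_def by (intro card_image_le) (simp add: finB finite_PiE)
    also have "\<dots> = M ^ s * card B"
      by (simp add: card_cartesian_product card_PiE)
    also have "\<dots> \<le> M ^ s * k ^ card V"
      by (intro mult_left_mono cardB) simp
    finally show "L ^ card V \<le> (card V ^ s * k ^ card V) * L ^ s"
      by (simp add: M_def power_mult_distrib mult_ac)
  qed
qed simp

section \<open>Chains of prime ideals\<close>

lemma ideal_kernel: "ideal {p \<in> polys V. subst g p = 0} (mpoly_ring V)"
  by (rule ideal_mpoly_ringI) (auto simp: polys_intros subst_add subst_mult)

text \<open>The kernel of a homomorphism into an integral domain is prime; it is proper since 1 maps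
  to 1.\<close>

lemma primeideal_kernel:
  "primeideal {p \<in> polys V. subst g p = (0 :: 'k::field mpoly)} (mpoly_ring V)"
proof (rule primeidealI[OF ideal_kernel cring_mpoly_ring])
  show "polys V \<noteq> {p \<in> polys V. subst g p = (0 :: 'k mpoly)}"
  proof
    assume "polys V = {p \<in> polys V. subst g p = (0 :: 'k mpoly)}"
    then have "(1 :: 'k mpoly) \<in> {p \<in> polys V. subst g p = 0}"
      using polys_1 by blast
    then show False by simp
  qed
qed (simp add: mpoly_ring_sel subst_mult polys_mult)

text \<open>The residue classes of the \<open>y i\<close> with \<open>i\<close> in \<open>S\<close>
  are algebraically independent over \<open>K\<close> in the quotient by \<open>P\<close>; this
  phrasing avoids forming quotient rings.\<close>

definition indep_mod :: "nat set \<Rightarrow> nat set \<Rightarrow> (nat \<Rightarrow> 'k::comm_ring_1 mpoly) \<Rightarrow> 'k mpoly set \<Rightarrow> bool" where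
  "indep_mod V S y P \<longleftrightarrow> (\<forall>i\<in>S. y i \<in> polys V) \<and> (\<forall>F\<in>polys S. F \<noteq> 0 \<longrightarrow> subst y F \<notin> P)"

text \<open>The terms free of the variable \<open>j\<close> are separated from those divisible by
  it. The last clause records that each exponent of \<open>j\<close> in \<open>F1\<close> is one
  less than an exponent in \<open>F\<close>, which drives an induction on the degree in that
  variable.\<close>

lemma split_variable:
  fixes F :: "'k::comm_ring_1 mpoly"
  assumes F: "F \<in> polys (insert j S)"
  obtains F0 F1 where "F = F0 + var j * F1" "F0 \<in> polys S" "F1 \<in> polys (insert j S)"
    "\<And>m. m \<in> Poly_Mapping.keys F1 \<Longrightarrow> m + Poly_Mapping.single j 1 \<in> Poly_Mapping.keys F"
proof
  let ?K = "Poly_Mapping.keys F"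
  let ?A = "{m \<in> ?K. j \<notin> Poly_Mapping.keys m}" and ?B = "{m \<in> ?K. j \<in> Poly_Mapping.keys m}"
  let ?e = "Poly_Mapping.single j (1::nat)"
  define F0 where "F0 = (\<Sum>m\<in>?A. Poly_Mapping.single m (Poly_Mapping.lookup F m))"
  define F1 where "F1 = (\<Sum>m\<in>?B. Poly_Mapping.single (m - ?e) (Poly_Mapping.lookup F m))"
  have e: "?e + (m - ?e) = m" if "j \<in> Poly_Mapping.keys m" for m
    using that
    by (intro poly_mapping_eqI) (auto simp: lookup_add lookup_minus lookup_single when_def in_keys_iff)
  have "var j * F1 = (\<Sum>m\<in>?B. Poly_Mapping.single m (Poly_Mapping.lookup F m))"
    unfolding F1_def sum_distrib_left var_def by (intro sum.cong) (auto simp: mult_single e[simplified])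
  moreover have "F = (\<Sum>m\<in>?A \<union> ?B. Poly_Mapping.single m (Poly_Mapping.lookup F m))"
    using poly_mapping_sum_single[of F] by (simp add: Collect_disj_eq[symmetric] conj_disj_distribL[symmetric])
  ultimately show "F = F0 + var j * F1"
    unfolding F0_def by (subst (asm) sum.union_disjoint) auto
  show "F0 \<in> polys S"
    unfolding F0_def using F by (intro polys_sum polys_single) (auto simp: polys_iff)
  have "Poly_Mapping.keys (m - ?e) \<subseteq> Poly_Mapping.keys m" for m
    by (auto simp: in_keys_iff lookup_minus)
  then show "F1 \<in> polys (insert j S)"
    unfolding F1_def using F by (intro polys_sum polys_single) (fastforce simp: polys_iff)
  show "m + ?e \<in> ?K" if m: "m \<in> Poly_Mapping.keys F1" for m
  proof -
    have "m \<in> (\<Union>n\<in>?B. Poly_Mapping.keys (Poly_Mapping.single (n - ?e) (Poly_Mapping.lookup F n)))"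
      using m unfolding F1_def by (rule subsetD[OF keys_sum])
    then obtain n where "n \<in> ?B" "m = n - ?e"
      by (auto split: if_splits)
    then show ?thesis
      using e[of n] by (simp add: add.commute)
  qed
qed

text \<open>Suppose \<open>F = F0 + var j * F1\<close> evaluates into \<open>P'\<close>. Modulo
  \<open>P\<close> the element \<open>y j\<close> vanishes, so a nonzero \<open>F0\<close> would
  violate independence modulo \<open>P\<close>. If \<open>F0 = 0\<close>, primality of
  \<open>P'\<close> allows cancelling \<open>y j\<close>, and \<open>F1\<close> has smaller degree
  in the variable \<open>j\<close>.\<close>

lemma indep_mod_insert:
  fixes y :: "nat \<Rightarrow> 'k::field mpoly"
  assumes P: "ideal P (mpoly_ring V)" and P': "primeideal P' (mpoly_ring V)" "P' \<subseteq> P"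
    and yj: "y j \<in> P" "y j \<notin> P'" and ind: "indep_mod V S y P"
  shows "indep_mod V (insert j S) y P'"
proof -
  have y: "y i \<in> polys V" if "i \<in> insert j S" for i
    using that yj ideal_mpoly_ringD(1)[OF P] ind by (auto simp: indep_mod_def)
  \<comment> \<open>The number \<open>a\<close> is a strict bound on the degree in the variable
    \<open>j\<close>, so \<open>a = 0\<close> leaves only the zero polynomial.\<close>
  have "subst y F \<notin> P'"
    if "F \<in> polys (insert j S)" "F \<noteq> 0" "\<forall>m\<in>Poly_Mapping.keys F. Poly_Mapping.lookup m j < a" for F a
    using that
  proof (induction a arbitrary: F)
    case 0
    then have "Poly_Mapping.keys F = {}" by auto
    then show ?case using 0 by simp
  next
    case (Suc a)
    obtain F0 F1 where F: "F = F0 + var j * F1" "F0 \<in> polys S" "F1 \<in> polys (insert j S)"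
      and keys: "\<And>m. m \<in> Poly_Mapping.keys F1 \<Longrightarrow> m + Poly_Mapping.single j 1 \<in> Poly_Mapping.keys F"
      using split_variable[OF Suc.prems(1)] by blast
    have F1: "subst y F1 \<in> polys V"
      using F(3) y by (rule subst_in_polys)
    have eq: "subst y F = subst y F0 + y j * subst y F1"
      by (simp add: F(1) subst_add subst_mult)
    show ?case
    proof (cases "F0 = 0")
      case False
      show ?thesis
      proof
        assume "subst y F \<in> P'"
        then have "subst y F \<in> P" using P'(2) by blast
        moreover have "y j * subst y F1 \<in> P"
          using ideal_mpoly_ringD(4)[OF P yj(1) F1] by (simp add: mult.commute)
        ultimately have "subst y F - y j * subst y F1 \<in> P"
          by (rule ideal_diff[OF P])
        then show False
          using ind False F(2) by (simp add: eq indep_mod_def)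
      qed
    next
      case True
      then have "F1 \<noteq> 0" using F(1) Suc.prems(2) by auto
      moreover have "\<forall>m\<in>Poly_Mapping.keys F1. Poly_Mapping.lookup m j < a"
        using keys Suc.prems(3) by (fastforce simp: lookup_add)
      ultimately have "subst y F1 \<notin> P'"
        using Suc.IH F(3) by blast
      then show ?thesis
        using primeideal.I_prime[OF P'(1), of "y j" "subst y F1"] y[of j] F1 yj(2) True
        by (auto simp: eq mpoly_ring_sel)
    qed
  qed
  moreover have "\<exists>a. \<forall>m\<in>Poly_Mapping.keys F. Poly_Mapping.lookup m j < a" for F :: "'k mpoly"
  proof -
    have "finite ((\<lambda>m. Poly_Mapping.lookup m j) ` Poly_Mapping.keys F)" by simp
    then show ?thesis
      unfolding finite_nat_set_iff_bounded by blast
  qed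
  ultimately show ?thesis
    using y unfolding indep_mod_def by blast
qed

text \<open>Each step down the chain enlarges the independent family by one element. At the bottom,
  independence modulo \<open>P 0\<close> implies plain algebraic independence because 0 lies in
  \<open>P 0\<close>, and the transcendence bound applies.\<close>

lemma prime_chain_length_le:
  fixes y :: "nat \<Rightarrow> 'k::field mpoly"
  assumes "prime_chain (mpoly_ring V) k P" "indep_mod V S y (P k)" "finite S" "finite V"
  shows "card S + k \<le> card V"
  using assms
proof (induction k arbitrary: S y)
  case 0
  then have "0 \<in> P 0"
    using ideal_mpoly_ringD(2)[OF primeideal.axioms(1)] by (auto simp: prime_chain_def)
  then have "subst y F \<noteq> 0" if "F \<in> polys S" "F \<noteq> 0" for F
    using that 0(2) unfolding indep_mod_def by metis
  then have "card S \<le> card V"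
    using 0 by (intro alg_indep_card_le) (auto simp: indep_mod_def)
  then show ?case by simp
next
  case (Suc k)
  have chain: "prime_chain (mpoly_ring V) k P" and prime: "primeideal (P k) (mpoly_ring V)"
      "primeideal (P (Suc k)) (mpoly_ring V)" and sub: "P k \<subset> P (Suc k)"
    using Suc.prems(1) by (auto simp: prime_chain_def)
  obtain z where z: "z \<in> P (Suc k)" "z \<notin> P k"
    using sub by blast
  \<comment> \<open>A fresh index, so that assigning \<open>z\<close> to it does not disturb the
    family on \<open>S\<close>.\<close>
  obtain j where j: "j \<notin> S"
    using Suc.prems(3) ex_new_if_finite infinite_UNIV_nat by blast
  let ?y = "y(j := z)"
  have "subst ?y F = subst y F" if "F \<in> polys S" for F
    using that j by (intro subst_cong[of _ S]) auto
  then have "indep_mod V S ?y (P (Suc k))"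
    using Suc.prems(2) j by (auto simp: indep_mod_def)
  then have "indep_mod V (insert j S) ?y (P k)"
    using prime sub z by (intro indep_mod_insert[of "P (Suc k)"] primeideal.axioms(1)) auto
  then have "card (insert j S) + k \<le> card V"
    using Suc.prems chain by (intro Suc.IH) auto
  then show ?case
    using j Suc.prems(3) by simp
qed

section \<open>The height of the ideal\<close>

lemma height_I_ideal_le:
  assumes "n \<ge> 5"
  shows "height (mpoly_ring {1..n}) (I_ideal n :: 'k::field mpoly set) \<le> 2"
proof -
  \<comment> \<open>Setting \<open>x_1 = x_3 = 0\<close> kills all generators; the kernel
    \<open>Q\<close> of this substitution is the prime ideal generated by these two
    variables.\<close>
  define g :: "nat \<Rightarrow> 'k mpoly" where "g i = (if i = 1 \<or> i = 3 then 0 else var i)" for i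
  define Q where "Q = {p \<in> polys {1..n}. subst g p = 0}"
  let ?S = "{1..n} - {1, 3}"
  have prime: "primeideal Q (mpoly_ring {1..n})"
    unfolding Q_def by (rule primeideal_kernel)
  have "I_ideal n \<subseteq> Q"
    unfolding I_ideal_def using assms prime
    by (intro Idl_minimal primeideal.axioms(1))
      (auto simp: Q_def g_def subst_add subst_mult intro!: polys_intros)
  then have "height (mpoly_ring {1..n}) (I_ideal n :: 'k mpoly set) \<le> prime_height (mpoly_ring {1..n}) Q"
    unfolding height_def using prime by (intro Inf_lower) auto
  also have "\<dots> \<le> 2"
    unfolding prime_height_def
  proof (rule Sup_least, clarify)
    fix k P assume P: "prime_chain (mpoly_ring {1..n}) k P" "Q = P k"
    \<comment> \<open>A polynomial in the other variables is fixed by \<open>g\<close>, so it lies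
      in \<open>Q\<close> only if it is zero.\<close>
    have "subst g F = F \<and> subst var F = F" if "F \<in> polys ?S" for F :: "'k mpoly"
      using that by (auto intro!: subst_eq_self simp: g_def split: if_splits)
    then have "indep_mod {1..n} ?S var Q"
      by (auto simp: indep_mod_def Q_def intro: var_in_carrier)
    then have "card ?S + k \<le> card {1..n}"
      using P by (intro prime_chain_length_le) auto
    moreover have "card ?S = n - 2"
      using assms by (subst card_Diff_subset) auto
    ultimately have "k \<le> 2"
      using assms by auto
    then show "enat k \<le> 2"
      by (simp add: numeral_eq_enat)
  qed
  finally show ?thesis .
qed

section \<open>Lower bound for the arithmetical rank\<close>

lemma I_ideal_gens_in_polys:
  assumes "n \<ge> 5"
  shows "{var 1 * var 2 + var 3 * var 4} \<union> {var 1 * var j | j. j \<in> {5..n}} \<union> {var 3 * var j | j. j \<in> {5..n}}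
    \<subseteq> (polys {1..n} :: 'k::field mpoly set)"
  using assms by (auto intro!: polys_intros)

text \<open>Under \<open>x_1 = 1\<close>, \<open>x_3 = x_4 = 0\<close> the generators become the
  variables indexed by \<open>W = {2, 5, ..., n}\<close> and zeros. The images of a list generating
  up to radical therefore generate the ideal of the origin in these \<open>n - 3\<close> variables
  up to radical.\<close>

lemma ara_I_ideal_ge:
  assumes n: "n \<ge> 5"
    and gen: "generates_up_to_radical (mpoly_ring {1..n}) ps (I_ideal n :: 'k::field mpoly set)"
  shows "n - 3 \<le> length ps"
proof -
  let ?R = "mpoly_ring {1..n} :: 'k mpoly ring"
  define W where "W = insert 2 {5..n}"
  define g :: "nat \<Rightarrow> 'k mpoly" where "g i = (if i \<in> W then var i else if i = 1 then 1 else 0)" for i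
  define p where "p i = subst g (ps ! i)" for i
  define s where "s = length ps"
  have ps: "set ps \<subseteq> polys {1..n}" "radical ?R (I_ideal n) = radical ?R (Idl\<^bsub>?R\<^esub> (set ps))"
    using gen by (auto simp: generates_up_to_radical_def)
  have g_W: "subst g F \<in> polys W" for F
  proof (rule subst_in_polys)
    show "F \<in> polys UNIV" by (simp add: polys_iff)
    show "g i \<in> polys W" for i by (auto simp: g_def intro: var_in_carrier)
  qed
  have lookup_p: "Poly_Mapping.lookup (p i) 0 = 0" if "i < s" for i
  proof -
    \<comment> \<open>The point with \<open>x_1 = 1\<close> and all other coordinates 0 is a zero of
      the ideal, hence of everything in its radical. It is the origin after the substitution
      \<open>g\<close>, so each \<open>p i\<close> has constant term 0.\<close>
    define h :: "nat \<Rightarrow> 'k mpoly" where "h i = (if i = 1 then 1 else 0)" for i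
    have "I_ideal n \<subseteq> {p \<in> polys {1..n}. subst h p = 0}"
      unfolding I_ideal_def using I_ideal_gens_in_polys[OF n]
      by (intro Idl_minimal ideal_kernel) (auto simp: h_def subst_add subst_mult)
    moreover have "ps ! i \<in> radical ?R (I_ideal n)"
      using that Idl_self[OF ps(1)] subset_radical[OF Idl_ideal[OF ps(1)]]
      unfolding ps(2) s_def by (meson nth_mem subsetD)
    ultimately obtain k where "subst h ((ps ! i) ^ k) = 0"
      unfolding radical_mpoly_ring by blast
    then have "subst h (ps ! i) = 0"
      by (simp add: subst_power)
    moreover have "h = (\<lambda>i. subst (\<lambda>_. 0) (g i))"
      by (auto simp: h_def g_def W_def)
    ultimately have "subst (\<lambda>_. 0) (p i) = 0"
      by (simp add: p_def subst_subst)
    then have "Poly_Mapping.lookup (Poly_Mapping.single (0 :: nat \<Rightarrow>\<^sub>0 nat) (Poly_Mapping.lookup (p i) 0)) 0 = 0"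
      by (simp add: subst_zero)
    then show ?thesis by simp
  qed
  \<comment> \<open>\<open>Q\<close> describes the ideal generated by the \<open>p i\<close> in the
    ring on \<open>W\<close>; its preimage under \<open>subst g\<close> is an ideal containing
    \<open>ps\<close>.\<close>
  define Q where "Q f \<longleftrightarrow> (\<exists>h. (\<forall>i. h i \<in> polys W) \<and> f = (\<Sum>i<s. h i * p i))" for f
  have Q_mult: "Q (c * f)" if "Q f" "c \<in> polys W" for c f
  proof -
    from that obtain h where "\<forall>i. h i \<in> polys W" "f = (\<Sum>i<s. h i * p i)"
      by (auto simp: Q_def)
    then show ?thesis
      using that(2) unfolding Q_def
      by (intro exI[of _ "\<lambda>i. c * h i"]) (auto simp: polys_mult sum_distrib_left mult.assoc)
  qed
  have "ideal {f \<in> polys {1..n}. Q (subst g f)} ?R"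
  proof (rule ideal_mpoly_ringI)
    show "0 \<in> {f \<in> polys {1..n}. Q (subst g f)}"
      by (auto simp: Q_def intro!: exI[of _ "\<lambda>_. 0"])
    show "a + b \<in> {f \<in> polys {1..n}. Q (subst g f)}"
      if ab: "a \<in> {f \<in> polys {1..n}. Q (subst g f)}" "b \<in> {f \<in> polys {1..n}. Q (subst g f)}" for a b
    proof -
      from ab obtain h h' where "\<forall>i. h i \<in> polys W" "\<forall>i. h' i \<in> polys W"
        "subst g a = (\<Sum>i<s. h i * p i)" "subst g b = (\<Sum>i<s. h' i * p i)"
        by (auto simp: Q_def)
      then have "Q (subst g (a + b))"
        unfolding Q_def
        by (intro exI[of _ "\<lambda>i. h i + h' i"]) (auto simp: polys_add subst_add distrib_right sum.distrib)
      then show ?thesis using ab by (simp add: polys_add)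
    qed
    show "c * a \<in> {f \<in> polys {1..n}. Q (subst g f)}"
      if "a \<in> {f \<in> polys {1..n}. Q (subst g f)}" "c \<in> polys {1..n}" for a c
      using that Q_mult g_W by (simp add: polys_mult subst_mult)
  qed auto
  moreover have "set ps \<subseteq> {f \<in> polys {1..n}. Q (subst g f)}"
  proof
    fix f assume f: "f \<in> set ps"
    then obtain i where i: "i < s" "f = ps ! i"
      by (auto simp: in_set_conv_nth s_def)
    have "(\<Sum>j<s. (if j = i then 1 else 0) * p j) = p i"
      using i by (simp add: if_distrib[of "\<lambda>c. c * _"] cong: if_cong)
    then have "Q (p i)"
      unfolding Q_def by (intro exI[of _ "\<lambda>j. if j = i then 1 else 0"]) auto
    then show "f \<in> {f \<in> polys {1..n}. Q (subst g f)}"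
      using f ps(1) i by (auto simp: p_def)
  qed
  ultimately have Idl_Q: "Idl\<^bsub>?R\<^esub> (set ps) \<subseteq> {f \<in> polys {1..n}. Q (subst g f)}"
    by (rule Idl_minimal)
  have "\<exists>k. Q (var v ^ k)" if v: "v \<in> W" for v
  proof -
    \<comment> \<open>An element of the ideal whose image under \<open>subst g\<close> is exactly
      \<open>var v\<close>.\<close>
    define e where "e = (if v = 2 then var 1 * var 2 + var 3 * var 4 else var 1 * var v :: 'k mpoly)"
    have "e \<in> I_ideal n"
      unfolding I_ideal_def using v
      by (intro subsetD[OF Idl_self[OF I_ideal_gens_in_polys[OF n]]]) (auto simp: e_def W_def)
    moreover have "ideal (I_ideal n) ?R"
      unfolding I_ideal_def by (rule Idl_ideal[OF I_ideal_gens_in_polys[OF n]])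
    ultimately have "e \<in> radical ?R (Idl\<^bsub>?R\<^esub> (set ps))"
      using subset_radical ps(2) by blast
    then obtain k where "e ^ k \<in> Idl\<^bsub>?R\<^esub> (set ps)"
      by (auto simp: radical_mpoly_ring)
    then have "Q (subst g (e ^ k))"
      using Idl_Q by blast
    moreover have "subst g e = var v"
      using v by (auto simp: e_def g_def W_def subst_add subst_mult)
    ultimately show ?thesis
      by (auto simp: subst_power)
  qed
  then obtain kf where kf: "\<And>v. v \<in> W \<Longrightarrow> Q (var v ^ kf v)"
    by metis
  have finW: "finite W"
    by (simp add: W_def)
  \<comment> \<open>A common exponent for all variables; the successor makes it positive.\<close>
  define k where "k = Suc (\<Sum>v\<in>W. kf v)"
  have "Q (var v ^ k)" if v: "v \<in> W" for v
  proof -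
    have "kf v \<le> k"
      using member_le_sum[of v W kf] v finW by (simp add: k_def)
    then have "(var v ^ k :: 'k mpoly) = var v ^ (k - kf v) * var v ^ kf v"
      by (simp flip: power_add)
    then show ?thesis
      using Q_mult[OF kf[OF v]] v by (simp add: polys_power var_in_carrier)
  qed
  then obtain h where h: "\<And>v. v \<in> W \<Longrightarrow> (\<forall>i. h v i \<in> polys W) \<and> var v ^ k = (\<Sum>i<s. h v i * p i)"
    unfolding Q_def by metis
  have "card W \<le> s"
  proof (rule origin_ideal_card_le[OF finW])
    show "p i \<in> polys W" for i
      by (simp add: p_def g_W)
    show "k > 0" by (simp add: k_def)
  qed (use h lookup_p in auto)
  moreover have "card W = n - 3"
    using n by (simp add: W_def)
  ultimately show ?thesis
    by (simp add: s_def)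
qed

section \<open>Upper bound for the arithmetical rank\<close>

text \<open>The ideal generated by \<open>u ^ m\<close> and \<open>v ^ m\<close> contains the
  \<open>m\<close>-th powers of both \<open>u * u'\<close> and \<open>v * v'\<close>, hence the
  \<open>2m\<close>-th power of their sum.\<close>

lemma power_sum_decomposition:
  assumes "u \<in> polys V" "u' \<in> polys V" "v \<in> polys V" "v' \<in> polys V"
  obtains A B where "A \<in> polys V" "B \<in> polys V" "(u * u' + v * v') ^ (m + m) = u ^ m * A + v ^ m * B"
proof -
  define I where "I = {u ^ m * A + v ^ m * B | A B. A \<in> polys V \<and> B \<in> polys V}"
  have "ideal I (mpoly_ring V)"
  proof (rule ideal_mpoly_ringI)
    show "I \<subseteq> polys V"
      using assms by (auto simp: I_def intro!: polys_intros)
    show "0 \<in> I"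
      by (auto simp: I_def intro!: exI[of _ 0])
    show "a + b \<in> I" if "a \<in> I" "b \<in> I" for a b
    proof -
      from that obtain A B A' B' where "A \<in> polys V" "B \<in> polys V" "A' \<in> polys V" "B' \<in> polys V"
        "a = u ^ m * A + v ^ m * B" "b = u ^ m * A' + v ^ m * B'"
        by (auto simp: I_def)
      then show ?thesis
        unfolding I_def by (intro CollectI exI[of _ "A + A'"] exI[of _ "B + B'"]) (auto simp: polys_add algebra_simps)
    qed
    show "c * a \<in> I" if "a \<in> I" "c \<in> polys V" for a c
    proof -
      from that obtain A B where "A \<in> polys V" "B \<in> polys V" "a = u ^ m * A + v ^ m * B"
        by (auto simp: I_def)
      then show ?thesis
        unfolding I_def using that(2)
        by (intro CollectI exI[of _ "c * A"] exI[of _ "c * B"]) (auto simp: polys_mult algebra_simps)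
    qed
  qed
  moreover have "(u * u') ^ m \<in> I"
    unfolding I_def using assms
    by (intro CollectI exI[of _ "u' ^ m"] exI[of _ 0]) (auto simp: polys_power power_mult_distrib)
  moreover have "(v * v') ^ m \<in> I"
    unfolding I_def using assms
    by (intro CollectI exI[of _ 0] exI[of _ "v' ^ m"]) (auto simp: polys_power power_mult_distrib)
  ultimately have "(u * u' + v * v') ^ (m + m) \<in> I"
    using assms by (intro power_add_mem) (auto intro: polys_mult)
  then show thesis
    using that by (auto simp: I_def)
qed

lemma ara_I_ideal_le:
  assumes n: "n \<ge> 5"
  shows "\<exists>ps. length ps = n - 3 \<and> generates_up_to_radical (mpoly_ring {1..n}) ps (I_ideal n :: 'k::field mpoly set)"
proof -
  \<comment> \<open>This keeps the index in \<open>x 1\<close> from being rewritten to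
    \<open>Suc 0\<close>.\<close>
  note One_nat_def [simp del]
  let ?V = "{1..n}"
  let ?R = "mpoly_ring ?V :: 'k mpoly ring"
  define x :: "nat \<Rightarrow> 'k mpoly" where "x = var"
  define q where "q = x 1 * x 2 + x 3 * x 4"
  define m where "m = n - 4"
  have x: "x i \<in> polys ?V" if "1 \<le> i" "i \<le> n" for i
    using that by (auto simp: x_def intro: var_in_carrier)
  obtain A B where AB: "A \<in> polys ?V" "B \<in> polys ?V" "q ^ (m + m) = x 1 ^ m * A + x 3 ^ m * B"
    unfolding q_def
    by (rule power_sum_decomposition[OF x[of 1] x[of 2] x[of 3] x[of 4], of m]) (use n in auto)
  define ps where "ps = [A * q + x 3 * x n, B * q - x 1 * x 5] @ map (\<lambda>k. x 1 * x (Suc k) - x 3 * x k) [5..<n]"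
  define T where "T = {x 1 * x 2 + x 3 * x 4} \<union> {x 1 * x j | j. j \<in> {5..n}} \<union> {x 3 * x j | j. j \<in> {5..n}}"
  define I where "I = Idl\<^bsub>?R\<^esub> T"
  define J where "J = Idl\<^bsub>?R\<^esub> (set ps)"
  have q: "q \<in> polys ?V"
    using n by (auto simp: q_def intro!: polys_intros x)
  have T: "T \<subseteq> polys ?V"
    unfolding T_def x_def by (rule I_ideal_gens_in_polys[OF n])
  have psV: "set ps \<subseteq> polys ?V"
    using n AB q by (auto simp: ps_def intro!: polys_add polys_diff polys_mult x)
  have psI: "set ps \<subseteq> I"
  proof -
    have I: "ideal I ?R"
      unfolding I_def by (rule Idl_ideal[OF T])
    have "T \<subseteq> I"
      unfolding I_def by (rule Idl_self[OF T])
    then have TI: "q \<in> I" "\<And>j. j \<in> {5..n} \<Longrightarrow> x 1 * x j \<in> I" "\<And>j. j \<in> {5..n} \<Longrightarrow> x 3 * x j \<in> I"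
      by (auto simp: T_def q_def)
    show ?thesis
      using n AB TI unfolding ps_def
      by (auto intro!: ideal_mpoly_ringD(3)[OF I] ideal_diff[OF I] intro: ideal_mpoly_ringD(4)[OF I])
  qed
  have TJ: "T \<subseteq> radical ?R J"
  proof -
    have J: "ideal J ?R"
      unfolding J_def by (rule Idl_ideal[OF psV])
    note JD = ideal_mpoly_ringD[OF J]
    have R: "ideal (radical ?R J) ?R"
      by (rule ideal_radical[OF J])
    note RD = ideal_mpoly_ringD[OF R]
    have JR: "J \<subseteq> radical ?R J"
      by (rule subset_radical[OF J])
    have "set ps \<subseteq> J"
      unfolding J_def by (rule Idl_self[OF psV])
    then have FJ: "A * q + x 3 * x n \<in> J" and GJ: "B * q - x 1 * x 5 \<in> J"
      and MJ: "\<And>k. 5 \<le> k \<Longrightarrow> k < n \<Longrightarrow> x 1 * x (Suc k) - x 3 * x k \<in> J"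
      by (auto simp: ps_def)
    \<comment> \<open>Modulo \<open>J\<close> multiplication by \<open>x 1\<close> turns
      \<open>x (Suc k)\<close> into \<open>x 3 * x k\<close>; iterating from \<open>5 + i\<close>
      down to 5 gives this congruence.\<close>
    have tel: "x 1 ^ i * x (5 + i) - x 3 ^ i * x 5 \<in> J" if "5 + i \<le> n" for i
      using that
    proof (induction i)
      case 0
      show ?case using JD(2) by simp
    next
      case (Suc i)
      have "x 1 ^ i * (x 1 * x (Suc (5 + i)) - x 3 * x (5 + i)) \<in> J"
        using Suc.prems n by (intro JD(4) MJ) (auto intro!: polys_power x)
      moreover have "x 3 * (x 1 ^ i * x (5 + i) - x 3 ^ i * x 5) \<in> J"
        using Suc n by (intro JD(4)) (auto intro!: x)
      ultimately have "x 1 ^ i * (x 1 * x (Suc (5 + i)) - x 3 * x (5 + i))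
          + x 3 * (x 1 ^ i * x (5 + i) - x 3 ^ i * x 5) \<in> J"
        by (rule JD(3))
      then show ?case by (simp add: algebra_simps)
    qed
    have "q ^ Suc (m + m) \<in> J"
    proof -
      \<comment> \<open>With \<open>l = m - 1 = n - 5\<close> the cross terms
        \<open>x 1 ^ m * x 3 * x n\<close> and \<open>x 3 ^ m * x 1 * x 5\<close> differ by
        \<open>x 1 * x 3\<close> times the congruence \<open>tel\<close>, and only the multiple of
        \<open>q\<close> survives.\<close>
      obtain l where l: "m = Suc l" "5 + l = n"
        using n by (intro that[of "n - 5"]) (auto simp: m_def)
      have "x 1 ^ m * (A * q + x 3 * x n) \<in> J" "x 3 ^ m * (B * q - x 1 * x 5) \<in> J"
        "(x 1 * x 3) * (x 1 ^ l * x n - x 3 ^ l * x 5) \<in> J"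
        using n FJ GJ tel[of l, unfolded l(2)] by (auto intro!: JD(4) polys_power polys_mult intro: x)
      then have "x 1 ^ m * (A * q + x 3 * x n) + x 3 ^ m * (B * q - x 1 * x 5)
          - (x 1 * x 3) * (x 1 ^ l * x n - x 3 ^ l * x 5) \<in> J"
        by (intro ideal_diff[OF J] JD(3))
      also have "x 1 ^ m * (A * q + x 3 * x n) + x 3 ^ m * (B * q - x 1 * x 5)
          - (x 1 * x 3) * (x 1 ^ l * x n - x 3 ^ l * x 5) = (x 1 ^ m * A + x 3 ^ m * B) * q"
        by (simp add: l(1) algebra_simps)
      also have "\<dots> = q ^ Suc (m + m)"
        by (simp add: AB(3) mult.commute)
      finally show ?thesis .
    qed
    then have qR: "q \<in> radical ?R J"
      using q by (intro radical_power_mem[OF subsetD[OF JR]])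
    \<comment> \<open>With \<open>q\<close> in the radical, the first two list elements release
      \<open>x 3 * x n\<close> and \<open>x 1 * x 5\<close>, the starting points of the two
      inductions below.\<close>
    have "(A * q + x 3 * x n) - A * q \<in> radical ?R J"
      using FJ JR AB qR by (intro ideal_diff[OF R] RD(4)) auto
    then have x3n: "x 3 * x n \<in> radical ?R J" by simp
    have "B * q - (B * q - x 1 * x 5) \<in> radical ?R J"
      using AB qR by (intro ideal_diff[OF R RD(4) subsetD[OF JR GJ]])
    then have x15: "x 1 * x 5 \<in> radical ?R J" by simp
    \<comment> \<open>Upwards from 5: modulo \<open>J\<close> the square of
      \<open>x 1 * x (Suc k)\<close> equals \<open>x 3 * x (Suc k)\<close> times
      \<open>x 1 * x k\<close>.\<close>
    have x1: "x 1 * x j \<in> radical ?R J" if "5 \<le> j" "j \<le> n" for j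
      using that
    proof (induction j rule: dec_induct)
      case (step k)
      have "(x 1 * x (Suc k)) * (x 1 * x (Suc k) - x 3 * x k) + (x 3 * x (Suc k)) * (x 1 * x k) \<in> radical ?R J"
        using step n MJ[of k] JR by (intro RD(3)[OF RD(4) RD(4)]) (auto intro!: polys_mult x)
      then have "(x 1 * x (Suc k)) ^ 2 \<in> radical ?R J"
        by (simp add: power2_eq_square algebra_simps)
      then show ?case
        by (rule radical_power_mem) (use step n in \<open>auto intro!: polys_mult x\<close>)
    qed (rule x15)
    \<comment> \<open>Downwards from \<open>n\<close>: modulo \<open>J\<close> the square of
      \<open>x 3 * x k\<close> equals \<open>x 1 * x k\<close> times
      \<open>x 3 * x (Suc k)\<close>.\<close>
    have x3: "x 3 * x j \<in> radical ?R J" if "j \<le> n" "5 \<le> j" for j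
      using that
    proof (induction j rule: inc_induct)
      case (step k)
      have "(x 1 * x k) * (x 3 * x (Suc k)) - (x 3 * x k) * (x 1 * x (Suc k) - x 3 * x k) \<in> radical ?R J"
      proof (rule ideal_diff[OF R RD(4) RD(4)])
        show "x 3 * x (Suc k) \<in> radical ?R J"
          by (rule step.IH) (use step.prems in simp)
        show "x 1 * x (Suc k) - x 3 * x k \<in> radical ?R J"
          using step MJ[of k] JR by auto
      qed (use step n in \<open>auto intro!: polys_mult x\<close>)
      then have "(x 3 * x k) ^ 2 \<in> radical ?R J"
        by (simp add: power2_eq_square algebra_simps)
      then show ?case
        by (rule radical_power_mem) (use step n in \<open>auto intro!: polys_mult x\<close>)
    qed (rule x3n)
    show ?thesis
      using qR x1 x3 by (auto simp: T_def q_def)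
  qed
  have "radical ?R (I_ideal n) = radical ?R (Idl\<^bsub>?R\<^esub> T)"
    by (simp add: I_ideal_def T_def x_def)
  also have "\<dots> = radical ?R (Idl\<^bsub>?R\<^esub> (set ps))"
    using psV T psI TJ unfolding I_def J_def by (intro radical_Idl_eqI)
  finally have "generates_up_to_radical ?R ps (I_ideal n)"
    using psV by (simp add: generates_up_to_radical_def)
  moreover have "length ps = n - 3"
    using n by (simp add: ps_def)
  ultimately show ?thesis by blast
qed

theorem mainTheorem1:
  fixes n :: nat
  assumes "n \<ge> 5"
  shows "ara (mpoly_ring {1..n}) (I_ideal n :: 'k::field mpoly set) = n - 3
    \<and> (n > 5 \<longrightarrow>
        \<not> set_theoretic_complete_intersection (mpoly_ring {1..n}) (I_ideal n :: 'k mpoly set))"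
proof -
  have ara: "ara (mpoly_ring {1..n}) (I_ideal n :: 'k mpoly set) = n - 3"
    unfolding ara_def using ara_I_ideal_le[OF assms] ara_I_ideal_ge[OF assms]
    by (intro Least_equality) auto
  moreover have "height (mpoly_ring {1..n}) (I_ideal n :: 'k mpoly set) \<noteq> enat (n - 3)" if "n > 5"
  proof -
    \<comment> \<open>For \<open>n > 5\<close> the arithmetical rank is at least 3 and so exceeds
      the height.\<close>
    have "\<not> enat (n - 3) \<le> 2"
      using that by (simp add: numeral_eq_enat)
    then show ?thesis
      using height_I_ideal_le[OF assms, where 'k = 'k] by metis
  qed
  ultimately show ?thesis
    by (simp add: set_theoretic_complete_intersection_def)
qed

end
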